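(* Let $G$ be a group of order $2^m$ of rank $5$ belonging to the isoclinism family $\Gamma_4$. Then (1) $\displaystyle A_G(t/|G|)=\frac{1-2^{-1}}{1-2^{-2}t} + \frac{2^{-1}-2^{-3}}{1-2^{-1}t} + \frac{2^{-3}}{1-t}$; (2) $\displaystyle B_G(t/|G|)=\frac{-2^{-1}}{1-2^{-3}t} + \frac{1}{1-2^{-2}t} + \frac{2^{-1}}{1-2^{-1}t}$.
   Context: For a finite group $G$ and $n\ge 0$, $\alpha_{G,n}$ denotes the number of orbits of $G$ acting on $G^n$ by simultaneous conjugation $g\cdot(x_1,\dots,x_n)=(gx_1g^{-1},\dots,gx_ng^{-1})$, and $\beta_{G,n}$ denotes the number of orbits of the same action on the set $G^{(n)}$ of $n$-tuples of pairwise commuting elements of $G$; $\alpha_{G,0}=\beta_{G,0}=1$. Set $A_G(t)=\sum_{n\ge 0}\alpha_{G,n}t^n$ and $B_G(t)=\sum_{n\ge 0}\beta_{G,n}t^n$ (formal power series, which are rational functions of $t$). $A_G(t/|G|)$, $B_G(t/|G|)$ denote the result of substituting $t/|G|$ for $t$. Finite groups $G,H$ are isoclinic if there are isomorphisms $\theta:G/Z(G)\to H/Z(H)$ and $\phi:G'\to H'$ (derived subgroups) such that $\phi([g_1,g_2])=[h_1,h_2]$ whenever $\theta(g_iZ(G))=h_iZ(H)$ for $i=1,2$. Isoclinism is an equivalence relation, whose classes are called isoclinism families. For a finite $2$-group $G$, the rank of (the family of) $G$ is the smallest $r$ such that the isoclinism family of $G$ contains a group of order $2^r$. $\Gamma_4$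 (Hall–Senior notation) is the isoclinism family, of rank 5, of the group of order $32$ $$\Gamma_4a_2=\langle \alpha_1,\alpha_2,\beta \mid \alpha_1^4 = \alpha_2^4 = \beta^2 = 1,\ \beta\alpha_1\beta^{-1} = \alpha_1^{-1},\ \beta\alpha_2\beta^{-1} = \alpha_2^{-1} \rangle ,$$ where by convention pairs of generators for which no conjugation relation is listed commute (so $\alpha_1\alpha_2=\alpha_2\alpha_1$). $G$ belongs to $\Gamma_4$ if $G$ is a finite $2$-group isoclinic to this group. *)

theory Defs
  imports
    "HOL-Algebra.Group_Action"
    "HOL-Algebra.Generated_Groups"
    "HOL-Computational_Algebra.Formal_Power_Series"
begin

section \<open>Orbits of tuples under simultaneous conjugation\<close>

definition tuples :: "('a, 'b) monoid_scheme \<Rightarrow> nat \<Rightarrow> 'a list set" where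
  "tuples G n = {xs. length xs = n \<and> set xs \<subseteq> carrier G}"

definition commuting_tuples :: "('a, 'b) monoid_scheme \<Rightarrow> nat \<Rightarrow> 'a list set" where
  "commuting_tuples G n =
     {xs \<in> tuples G n. \<forall>x \<in> set xs. \<forall>y \<in> set xs. x \<otimes>\<^bsub>G\<^esub> y = y \<otimes>\<^bsub>G\<^esub> x}"

text \<open>The restriction to the set \<open>E\<close> of tuples acted upon is what the locale
  \<^locale>\<open>group_action\<close> requires, since \<^const>\<open>BijGroup\<close> contains extensional functions only.\<close>

definition conj_tuple ::
    "('a, 'b) monoid_scheme \<Rightarrow> 'a list set \<Rightarrow> 'a \<Rightarrow> 'a list \<Rightarrow> 'a list" where
  "conj_tuple G E g = (\<lambda>xs \<in> E. map (\<lambda>x. g \<otimes>\<^bsub>G\<^esub> x \<otimes>\<^bsub>G\<^esub> inv\<^bsub>G\<^esub> g) xs)"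

definition alpha :: "('a, 'b) monoid_scheme \<Rightarrow> nat \<Rightarrow> nat" where
  "alpha G n = card (orbits G (tuples G n) (conj_tuple G (tuples G n)))"

definition beta :: "('a, 'b) monoid_scheme \<Rightarrow> nat \<Rightarrow> nat" where
  "beta G n = card (orbits G (commuting_tuples G n) (conj_tuple G (commuting_tuples G n)))"

definition A_series :: "('a, 'b) monoid_scheme \<Rightarrow> rat fps" where
  "A_series G = Abs_fps (\<lambda>n. of_nat (alpha G n))"

definition B_series :: "('a, 'b) monoid_scheme \<Rightarrow> rat fps" where
  "B_series G = Abs_fps (\<lambda>n. of_nat (beta G n))"


section \<open>Isoclinism\<close>

definition center :: "('a, 'b) monoid_scheme \<Rightarrow> 'a set" where
  "center G = {z \<in> carrier G. \<forall>g \<in> carrier G. z \<otimes>\<^bsub>G\<^esub> g = g \<otimes>\<^bsub>G\<^esub> z}"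

text \<open>Same convention as in \<^const>\<open>derived\<close>.\<close>

definition comm :: "('a, 'b) monoid_scheme \<Rightarrow> 'a \<Rightarrow> 'a \<Rightarrow> 'a" where
  "comm G x y = x \<otimes>\<^bsub>G\<^esub> y \<otimes>\<^bsub>G\<^esub> inv\<^bsub>G\<^esub> x \<otimes>\<^bsub>G\<^esub> inv\<^bsub>G\<^esub> y"

abbreviation derived_group :: "('a, 'b) monoid_scheme \<Rightarrow> ('a, 'b) monoid_scheme" where
  "derived_group G \<equiv> G\<lparr>carrier := derived G (carrier G)\<rparr>"

definition isoclinic :: "('a, 'b) monoid_scheme \<Rightarrow> ('c, 'd) monoid_scheme \<Rightarrow> bool" where
  "isoclinic G H \<longleftrightarrow>
     (\<exists>\<theta> \<in> iso (G Mod center G) (H Mod center H).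
      \<exists>\<phi> \<in> iso (derived_group G) (derived_group H).
        \<forall>g\<^sub>1 \<in> carrier G. \<forall>g\<^sub>2 \<in> carrier G. \<forall>h\<^sub>1 \<in> carrier H. \<forall>h\<^sub>2 \<in> carrier H.
          \<theta> (center G #>\<^bsub>G\<^esub> g\<^sub>1) = center H #>\<^bsub>H\<^esub> h\<^sub>1 \<longrightarrow>
          \<theta> (center G #>\<^bsub>G\<^esub> g\<^sub>2) = center H #>\<^bsub>H\<^esub> h\<^sub>2 \<longrightarrow>
          \<phi> (comm G g\<^sub>1 g\<^sub>2) = comm H h\<^sub>1 h\<^sub>2)"

definition two_group :: "('a, 'b) monoid_scheme \<Rightarrow> bool" where
  "two_group G \<longleftrightarrow> group G \<and> (\<exists>k. order G = 2 ^ k)"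

text \<open>Every finite group is isomorphic to one whose carrier consists of natural numbers, so
  letting \<open>H\<close> range over such groups covers the whole isoclinism family.\<close>

definition isoclinism_rank :: "('a, 'b) monoid_scheme \<Rightarrow> nat" where
  "isoclinism_rank G =
     (LEAST r. \<exists>H :: nat monoid. group H \<and> order H = 2 ^ r \<and> isoclinic G H)"


section \<open>Groups given by generators and relations\<close>

text \<open>A letter \<open>(x, True)\<close> stands for the generator \<open>x\<close>, and \<open>(x, False)\<close> for its formal
  inverse; a pair \<open>(l, r)\<close> of words in \<open>R\<close> stands for the relation \<open>l = r\<close>.\<close>

type_synonym 'g word = "('g \<times> bool) list"

inductive pres_eq :: "('g word \<times> 'g word) set \<Rightarrow> 'g word \<Rightarrow> 'g word \<Rightarrow> bool"
  for R :: "('g word \<times> 'g word) set" where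
  pres_refl: "pres_eq R w w"
| pres_sym: "pres_eq R v w \<Longrightarrow> pres_eq R w v"
| pres_trans: "pres_eq R u v \<Longrightarrow> pres_eq R v w \<Longrightarrow> pres_eq R u w"
| pres_cancel: "pres_eq R (u @ [(x, b), (x, \<not> b)] @ v) (u @ v)"
| pres_rel: "(l, r) \<in> R \<Longrightarrow> pres_eq R (u @ l @ v) (u @ r @ v)"

definition pres_class :: "('g word \<times> 'g word) set \<Rightarrow> 'g word \<Rightarrow> 'g word set" where
  "pres_class R w = {v. pres_eq R w v}"

definition presented_group :: "('g word \<times> 'g word) set \<Rightarrow> 'g word set monoid" where
  "presented_group R =
     \<lparr>carrier = range (pres_class R),
      monoid.mult = (\<lambda>X Y. \<Union>x \<in> X. \<Union>y \<in> Y. pres_class R (x @ y)),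
      one = pres_class R []\<rparr>"

lemma pres_eq_append_left: "pres_eq R v w \<Longrightarrow> pres_eq R (u @ v) (u @ w)"
proof (induction rule: pres_eq.induct)
  case (pres_cancel u' x b v)
  show ?case using pres_eq.pres_cancel[of R "u @ u'" x b v] by simp
next
  case (pres_rel l r u' v)
  then show ?case using pres_eq.pres_rel[of l r R "u @ u'" v] by simp
qed (fact pres_eq.pres_refl, erule pres_eq.pres_sym, erule (1) pres_eq.pres_trans)

lemma pres_eq_append_right: "pres_eq R v w \<Longrightarrow> pres_eq R (v @ u) (w @ u)"
proof (induction rule: pres_eq.induct)
  case (pres_cancel u' x b v)
  show ?case using pres_eq.pres_cancel[of R u' x b "v @ u"] by simp
next
  case (pres_rel l r u' v)
  then show ?case using pres_eq.pres_rel[of l r R u' "v @ u"] by simp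
qed (fact pres_eq.pres_refl, erule pres_eq.pres_sym, erule (1) pres_eq.pres_trans)

lemma pres_eq_append: "pres_eq R v w \<Longrightarrow> pres_eq R v' w' \<Longrightarrow> pres_eq R (v @ v') (w @ w')"
  by (rule pres_eq.pres_trans[OF pres_eq_append_right pres_eq_append_left])

lemma pres_class_eq_iff: "pres_class R v = pres_class R w \<longleftrightarrow> pres_eq R v w"
proof
  assume "pres_class R v = pres_class R w"
  moreover have "w \<in> pres_class R w" by (simp add: pres_class_def pres_eq.pres_refl)
  ultimately have "w \<in> pres_class R v" by simp
  then show "pres_eq R v w" by (simp add: pres_class_def)
next
  assume *: "pres_eq R v w"
  have "pres_eq R v x \<longleftrightarrow> pres_eq R w x" for x
    using pres_eq.pres_trans[OF *, of x] pres_eq.pres_trans[OF pres_eq.pres_sym[OF *], of x] by iprover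
  then show "pres_class R v = pres_class R w"
    by (simp add: pres_class_def)
qed

lemma presented_group_mult:
  "pres_class R v \<otimes>\<^bsub>presented_group R\<^esub> pres_class R w = pres_class R (v @ w)"
proof -
  have "pres_class R (x @ y) = pres_class R (v @ w)"
    if "x \<in> pres_class R v" "y \<in> pres_class R w" for x y
    unfolding pres_class_eq_iff
    using that by (intro pres_eq_append pres_eq.pres_sym[of R v x] pres_eq.pres_sym[of R w y])
      (simp_all add: pres_class_def)
  then have "(\<Union>x \<in> pres_class R v. \<Union>y \<in> pres_class R w. pres_class R (x @ y))
      = (\<Union>x \<in> pres_class R v. \<Union>y \<in> pres_class R w. pres_class R (v @ w))"
    by (intro SUP_cong HOL.refl)
  moreover have "v \<in> pres_class R v" "w \<in> pres_class R w"
    by (simp_all add: pres_class_def pres_eq.pres_refl)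
  ultimately show ?thesis
    unfolding presented_group_def by auto
qed

lemma pres_eq_inverse: "pres_eq R (rev (map (\<lambda>(x, b). (x, \<not> b)) w) @ w) []"
proof (induction w)
  case Nil
  show ?case by (simp add: pres_eq.pres_refl)
next
  case (Cons a w)
  obtain x b where a: "a = (x, b)" by (cases a)
  have "pres_eq R (rev (map (\<lambda>(x, b). (x, \<not> b)) (a # w)) @ a # w)
          (rev (map (\<lambda>(x, b). (x, \<not> b)) w) @ w)"
    using pres_eq.pres_cancel[of R "rev (map (\<lambda>(x, b). (x, \<not> b)) w)" x "\<not> b" w] by (simp add: a)
  with Cons.IH show ?case by (rule pres_eq.pres_trans[rotated])
qed

lemma group_presented_group: "group (presented_group R)"
proof (rule groupI)
  show "\<exists>Y \<in> carrier (presented_group R). Y \<otimes>\<^bsub>presented_group R\<^esub> X = \<one>\<^bsub>presented_group R\<^esub>"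
    if X_carr: "X \<in> carrier (presented_group R)" for X
  proof -
    obtain w where X: "X = pres_class R w"
      using X_carr by (auto simp: presented_group_def)
    have "pres_class R (rev (map (\<lambda>(x, b). (x, \<not> b)) w)) \<otimes>\<^bsub>presented_group R\<^esub> X
            = pres_class R []"
      by (simp add: X presented_group_mult pres_class_eq_iff pres_eq_inverse)
    then show ?thesis by (auto simp: presented_group_def)
  qed
next
  have carr: "carrier (presented_group R) = range (pres_class R)"
    and one: "\<one>\<^bsub>presented_group R\<^esub> = pres_class R []"
    by (simp_all add: presented_group_def)
  fix X Y Z
  assume X: "X \<in> carrier (presented_group R)"
  then show "\<one>\<^bsub>presented_group R\<^esub> \<otimes>\<^bsub>presented_group R\<^esub> X = X"
    by (auto simp: carr one presented_group_mult)
  assume Y: "Y \<in> carrier (presented_group R)"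
  with X show "X \<otimes>\<^bsub>presented_group R\<^esub> Y \<in> carrier (presented_group R)"
    by (auto simp: carr presented_group_mult)
  assume "Z \<in> carrier (presented_group R)"
  with X Y show "X \<otimes>\<^bsub>presented_group R\<^esub> Y \<otimes>\<^bsub>presented_group R\<^esub> Z =
      X \<otimes>\<^bsub>presented_group R\<^esub> (Y \<otimes>\<^bsub>presented_group R\<^esub> Z)"
    by (auto simp: carr presented_group_mult)
qed (simp add: presented_group_def)


section \<open>The isoclinism family $\Gamma_4$\<close>

datatype gen = Alpha1 | Alpha2 | Beta

abbreviation pos :: "'g \<Rightarrow> 'g \<times> bool" where "pos x \<equiv> (x, True)"
abbreviation neg :: "'g \<Rightarrow> 'g \<times> bool" where "neg x \<equiv> (x, False)"

definition Gamma4a2_rels :: "(gen word \<times> gen word) set" where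
  "Gamma4a2_rels =
     {(replicate 4 (pos Alpha1), []),
      (replicate 4 (pos Alpha2), []),
      (replicate 2 (pos Beta), []),
      ([pos Beta, pos Alpha1, neg Beta], [neg Alpha1]),
      ([pos Beta, pos Alpha2, neg Beta], [neg Alpha2]),
      ([pos Alpha1, pos Alpha2], [pos Alpha2, pos Alpha1])}"

definition Gamma4a2 :: "gen word set monoid" where
  "Gamma4a2 = presented_group Gamma4a2_rels"

definition in_Gamma4 :: "('a, 'b) monoid_scheme \<Rightarrow> bool" where
  "in_Gamma4 G \<longleftrightarrow> two_group G \<and> isoclinic G Gamma4a2"

end

theory Submission
  imports Defs
begin

text \<open>By Burnside's lemma \<open>|G| \<alpha>\<^sub>n\<close> is the sum of the \<open>|C(g)|\<^bsup>n\<^esup>\<close>, and \<open>|G| \<beta>\<^sub>n\<close> is the number of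
  commuting \<open>(n + 1)\<close>-tuples, the first entry being the element that fixes the remaining ones. Both
  depend only on which cosets of the centre commute, and isoclinic groups have the same commutation
  pattern on their central quotients; so it is enough to know this pattern for the group
  \<open>\<Gamma>\<^sub>4a\<^sub>2\<close>. Its central quotient is elementary abelian of order 8, and by the normal form
  \<open>\<alpha>\<^sub>1\<^bsup>i\<^esup> \<alpha>\<^sub>2\<^bsup>j\<^esup> \<beta>\<^bsup>k\<^esup>\<close> two elements \<open>(i, j, k)\<close> and \<open>(i', j', k')\<close> commute iff \<open>i k' = i' k\<close> and
  \<open>j k' = j' k\<close> modulo 2.\<close>

section \<open>Counting orbits of conjugation on tuples\<close>

definition centralizer :: "('a, 'b) monoid_scheme \<Rightarrow> 'a \<Rightarrow> 'a set" where
  "centralizer G g = {x \<in> carrier G. g \<otimes>\<^bsub>G\<^esub> x = x \<otimes>\<^bsub>G\<^esub> g}"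

lemma (in group) conj_eq_self_iff:
  assumes "g \<in> carrier G" "x \<in> carrier G"
  shows "g \<otimes> x \<otimes> inv g = x \<longleftrightarrow> g \<otimes> x = x \<otimes> g"
  using assms by (metis inv_solve_right m_closed)

lemma (in group) conj_conj:
  assumes "g \<in> carrier G" "h \<in> carrier G" "x \<in> carrier G"
  shows "g \<otimes> (h \<otimes> x \<otimes> inv h) \<otimes> inv g = (g \<otimes> h) \<otimes> x \<otimes> inv (g \<otimes> h)"
  using assms by (simp add: m_assoc inv_mult_group)

text \<open>Conjugation by \<open>inv g\<close> undoes conjugation by \<open>g\<close>, which gives
  the bijection, and \<open>conj_conj\<close> gives the homomorphism law. Leaving \<open>E\<close>
  arbitrary lets all tuples and commuting tuples share the proof.\<close>

lemma (in group) group_action_conj_tuple: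
  assumes E: "E \<subseteq> lists (carrier G)"
    and closed: "\<And>g xs. g \<in> carrier G \<Longrightarrow> xs \<in> E \<Longrightarrow> map (\<lambda>x. g \<otimes> x \<otimes> inv g) xs \<in> E"
  shows "group_action G E (conj_tuple G E)"
proof -
  have comp: "map (\<lambda>x. g \<otimes> x \<otimes> inv g) (map (\<lambda>x. h \<otimes> x \<otimes> inv h) xs)
      = map (\<lambda>x. (g \<otimes> h) \<otimes> x \<otimes> inv (g \<otimes> h)) xs"
    if "g \<in> carrier G" "h \<in> carrier G" "xs \<in> E" for g h xs
    using that E conj_conj by (auto simp: in_lists_conv_set subset_iff)
  have one: "map (\<lambda>x. \<one> \<otimes> x \<otimes> inv \<one>) xs = xs" if "xs \<in> E" for xs
    using that E by (intro map_idI) (auto simp: in_lists_conv_set subset_iff)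
  have bij: "conj_tuple G E g \<in> Bij E" if g: "g \<in> carrier G" for g
  proof -
    have "bij_betw (conj_tuple G E g) E E"
      using g closed[of g] closed[of "inv g"] comp[of "inv g" g] comp[of g "inv g"] one
      by (intro bij_betw_byWitness[where f' = "conj_tuple G E (inv g)"])
        (auto simp: conj_tuple_def simp del: map_map)
    then show ?thesis
      by (simp add: Bij_def conj_tuple_def)
  qed
  have "conj_tuple G E (g \<otimes> h) = compose E (conj_tuple G E g) (conj_tuple G E h)"
    if "g \<in> carrier G" "h \<in> carrier G" for g h
    using comp[OF that] closed[OF that(2)]
    by (auto simp: conj_tuple_def compose_def restrict_def fun_eq_iff simp del: map_map)
  then have "conj_tuple G E \<in> hom G (BijGroup E)"
    using bij by (auto simp: hom_def BijGroup_def)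
  then show ?thesis
    unfolding group_action_def group_hom_def
    by (simp add: group_BijGroup group_hom_axioms.intro is_group)
qed

text \<open>A tuple is fixed by \<open>g\<close> exactly when each entry is, so the fixed-point
  counts in Burnside's lemma become counts of lists over a centralizer.\<close>

lemma (in group) invariants_conj_tuple:
  assumes E: "E \<subseteq> lists (carrier G)" and g: "g \<in> carrier G"
  shows "invariants E (conj_tuple G E) g = {xs \<in> E. set xs \<subseteq> centralizer G g}"
proof -
  have "map (\<lambda>x. g \<otimes> x \<otimes> inv g) xs = xs \<longleftrightarrow> set xs \<subseteq> centralizer G g" if "xs \<in> E" for xs
  proof -
    have "map (\<lambda>x. g \<otimes> x \<otimes> inv g) xs = xs \<longleftrightarrow> (\<forall>x \<in> set xs. g \<otimes> x \<otimes> inv g = x)"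
      using map_eq_conv[of _ xs "\<lambda>x. x"] by simp
    also have "\<dots> \<longleftrightarrow> set xs \<subseteq> centralizer G g"
      using that E g conj_eq_self_iff by (auto simp: centralizer_def in_lists_conv_set subset_iff)
    finally show ?thesis .
  qed
  then show ?thesis
    by (auto simp: invariants_def conj_tuple_def)
qed

lemma finite_tuples: "finite (carrier G) \<Longrightarrow> finite (tuples G n)"
  unfolding tuples_def using finite_lists_length_eq[of "carrier G" n] by (simp add: conj_commute)

lemma tuples_subset_lists: "tuples G n \<subseteq> lists (carrier G)"
  by (auto simp: tuples_def)

lemma commuting_tuples_subset: "commuting_tuples G n \<subseteq> tuples G n"
  by (auto simp: commuting_tuples_def)

text \<open>The condition on \<open>xs\<close> is that of being a commuting tuple fixed by
  \<open>g\<close>; this turns Burnside's pairs of an element and a fixed tuple into longer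
  commuting tuples.\<close>

lemma Cons_commuting_tuple_iff:
  "g # xs \<in> commuting_tuples G (Suc n) \<longleftrightarrow>
    g \<in> carrier G \<and> xs \<in> commuting_tuples G n \<and> set xs \<subseteq> centralizer G g"
proof -
  have "(\<forall>x \<in> set (g # xs). \<forall>y \<in> set (g # xs). x \<otimes>\<^bsub>G\<^esub> y = y \<otimes>\<^bsub>G\<^esub> x) \<longleftrightarrow>
      (\<forall>x \<in> set xs. g \<otimes>\<^bsub>G\<^esub> x = x \<otimes>\<^bsub>G\<^esub> g) \<and> (\<forall>x \<in> set xs. \<forall>y \<in> set xs. x \<otimes>\<^bsub>G\<^esub> y = y \<otimes>\<^bsub>G\<^esub> x)"
    by (metis (no_types, lifting) set_ConsD list.set_intros)
  then show ?thesis
    unfolding commuting_tuples_def tuples_def centralizer_def subset_iff by simp blast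
qed

text \<open>Burnside's lemma: the fixed points of \<open>g\<close> are all lists of length
  \<open>n\<close> over its centralizer.\<close>

lemma (in group) alpha_times_order:
  assumes fin: "finite (carrier G)"
  shows "alpha G n * order G = (\<Sum>g \<in> carrier G. card (centralizer G g) ^ n)"
proof -
  interpret A: group_action G "tuples G n" "conj_tuple G (tuples G n)"
    by (rule group_action_conj_tuple[OF tuples_subset_lists]) (auto simp: tuples_def)
  have "card (invariants (tuples G n) (conj_tuple G (tuples G n)) g) = card (centralizer G g) ^ n"
    if "g \<in> carrier G" for g
  proof -
    have "invariants (tuples G n) (conj_tuple G (tuples G n)) g
        = {xs. set xs \<subseteq> centralizer G g \<and> length xs = n}"
      unfolding invariants_conj_tuple[OF tuples_subset_lists that]
      by (auto simp: tuples_def centralizer_def)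
    moreover have "finite (centralizer G g)"
      using fin by (simp add: centralizer_def)
    ultimately show ?thesis
      by (simp add: card_lists_length_eq)
  qed
  then show ?thesis
    using A.burnside[OF fin finite_tuples[OF fin]] by (simp add: alpha_def)
qed

text \<open>Burnside's lemma sums the fixed points over \<open>g\<close>; prepending
  \<open>g\<close> to each fixed tuple gives every commuting tuple of length \<open>Suc n\<close>
  exactly once.\<close>

lemma (in group) beta_times_order:
  assumes fin: "finite (carrier G)"
  shows "beta G n * order G = card (commuting_tuples G (Suc n))"
proof -
  let ?E = "commuting_tuples G n"
  have E: "?E \<subseteq> lists (carrier G)"
    using commuting_tuples_subset tuples_subset_lists by blast
  \<comment> \<open>Conjugation is multiplicative, so it keeps commuting entries commuting.\<close>
  have hom: "(g \<otimes> x \<otimes> inv g) \<otimes> (g \<otimes> y \<otimes> inv g) = g \<otimes> (x \<otimes> y) \<otimes> inv g"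
    if "g \<in> carrier G" "x \<in> carrier G" "y \<in> carrier G" for g x y
  proof -
    have "inv g \<otimes> (g \<otimes> (y \<otimes> inv g)) = y \<otimes> inv g"
      using that by (simp flip: m_assoc)
    then show ?thesis
      using that by (simp add: m_assoc)
  qed
  interpret A: group_action G ?E "conj_tuple G ?E"
  proof (rule group_action_conj_tuple[OF E])
    fix g xs assume g: "g \<in> carrier G" and xs: "xs \<in> ?E"
    then show "map (\<lambda>x. g \<otimes> x \<otimes> inv g) xs \<in> ?E"
      by (auto simp: commuting_tuples_def tuples_def hom subset_iff)
  qed
  have finE: "finite ?E"
    using finite_subset[OF commuting_tuples_subset finite_tuples[OF fin]] .
  let ?S = "SIGMA g:carrier G. {xs \<in> ?E. set xs \<subseteq> centralizer G g}"
  have "commuting_tuples G (Suc n) = (\<lambda>(g, xs). g # xs) ` ?S"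
  proof (intro subset_antisym subsetI)
    fix ys assume ys: "ys \<in> commuting_tuples G (Suc n)"
    then obtain g xs where "ys = g # xs"
      by (auto simp: commuting_tuples_def tuples_def length_Suc_conv)
    with ys show "ys \<in> (\<lambda>(g, xs). g # xs) ` ?S"
      by (simp add: image_iff Cons_commuting_tuple_iff)
  qed (auto simp: Cons_commuting_tuple_iff)
  moreover have "inj_on (\<lambda>(g, xs). g # xs) ?S"
    by (auto intro: inj_onI)
  ultimately have "card (commuting_tuples G (Suc n)) = card ?S"
    by (simp add: card_image)
  also have "\<dots> = (\<Sum>g \<in> carrier G. card {xs \<in> ?E. set xs \<subseteq> centralizer G g})"
    using fin finE by (simp add: card_SigmaI)
  also have "\<dots> = (\<Sum>g \<in> carrier G. card (invariants ?E (conj_tuple G ?E) g))"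
    using invariants_conj_tuple[OF E] by simp
  finally show ?thesis
    using A.burnside[OF fin finE] by (simp add: beta_def)
qed

section \<open>Isoclinism and commutation\<close>

lemma center_commute: "z \<in> center G \<Longrightarrow> g \<in> carrier G \<Longrightarrow> z \<otimes>\<^bsub>G\<^esub> g = g \<otimes>\<^bsub>G\<^esub> z"
  unfolding center_def by blast

lemma center_in_carrier: "z \<in> center G \<Longrightarrow> z \<in> carrier G"
  unfolding center_def by blast

lemma centerI:
  "z \<in> carrier G \<Longrightarrow> (\<And>g. g \<in> carrier G \<Longrightarrow> z \<otimes>\<^bsub>G\<^esub> g = g \<otimes>\<^bsub>G\<^esub> z) \<Longrightarrow> z \<in> center G"
  unfolding center_def by blast

lemma (in group) subgroup_center: "subgroup (center G) G"
proof
  show "center G \<subseteq> carrier G"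
    by (blast intro: center_in_carrier)
  show "\<one> \<in> center G"
    by (rule centerI) simp_all
next
  fix x y assume x: "x \<in> center G" and y: "y \<in> center G"
  note xy = x[THEN center_in_carrier] y[THEN center_in_carrier]
  show "x \<otimes> y \<in> center G"
  proof (rule centerI)
    fix g assume g: "g \<in> carrier G"
    have "(x \<otimes> y) \<otimes> g = x \<otimes> (g \<otimes> y)"
      using xy g by (simp add: m_assoc center_commute[OF y g])
    also have "\<dots> = (x \<otimes> g) \<otimes> y"
      using xy g by (simp add: m_assoc)
    also have "\<dots> = g \<otimes> (x \<otimes> y)"
      using xy g by (simp add: center_commute[OF x g] m_assoc)
    finally show "(x \<otimes> y) \<otimes> g = g \<otimes> (x \<otimes> y)" .
  qed (use xy in simp)
next
  fix x assume x: "x \<in> center G"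
  note x_carr = x[THEN center_in_carrier]
  show "inv x \<in> center G"
  proof (rule centerI)
    fix g assume g: "g \<in> carrier G"
    have "(inv x \<otimes> g) \<otimes> x = inv x \<otimes> (x \<otimes> g)"
      using x_carr g by (simp add: center_commute[OF x g] m_assoc)
    also have "\<dots> = g"
      using x_carr g by (simp flip: m_assoc)
    finally show "inv x \<otimes> g = g \<otimes> inv x"
      using inv_solve_right[of "inv x \<otimes> g" g x] g x_carr by simp
  qed (use x_carr in simp)
qed

text \<open>The commutator is the quotient of \<open>x \<otimes> y\<close> by
  \<open>y \<otimes> x\<close>.\<close>

lemma (in group) comm_eq_one_iff:
  assumes "x \<in> carrier G" "y \<in> carrier G"
  shows "comm G x y = \<one> \<longleftrightarrow> x \<otimes> y = y \<otimes> x"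
proof -
  have "comm G x y = (x \<otimes> y) \<otimes> inv (y \<otimes> x)"
    using assms by (simp add: comm_def m_assoc inv_mult_group)
  then show ?thesis
    using assms by (simp add: inv_solve_right')
qed

lemma (in group) comm_in_derived:
  "x \<in> carrier G \<Longrightarrow> y \<in> carrier G \<Longrightarrow> comm G x y \<in> derived G (carrier G)"
  unfolding derived_def comm_def by (blast intro: generate.incl)

lemma (in group) group_derived_group: "group (derived_group G)"
  by (intro subgroup_imp_group derived_is_subgroup) simp

text \<open>Being an injective homomorphism on the derived subgroup, \<phi> both preserves and
  reflects triviality of commutators.\<close>

lemma isoclinic_commute_iff:
  assumes "group G" "group H"
    and \<phi>: "\<phi> \<in> iso (derived_group G) (derived_group H)"
    and comm: "\<phi> (comm G x y) = comm H u v"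
    and "x \<in> carrier G" "y \<in> carrier G" "u \<in> carrier H" "v \<in> carrier H"
  shows "x \<otimes>\<^bsub>G\<^esub> y = y \<otimes>\<^bsub>G\<^esub> x \<longleftrightarrow> u \<otimes>\<^bsub>H\<^esub> v = v \<otimes>\<^bsub>H\<^esub> u"
proof -
  interpret G: group G by fact
  interpret H: group H by fact
  have "\<phi> \<one>\<^bsub>G\<^esub> = \<one>\<^bsub>H\<^esub>"
    using hom_one[OF _ G.group_derived_group H.group_derived_group, of \<phi>] \<phi> by (simp add: iso_def)
  moreover have "inj_on \<phi> (derived G (carrier G))"
    using \<phi> by (simp add: iso_def bij_betw_def)
  moreover have "\<one>\<^bsub>G\<^esub> \<in> derived G (carrier G)"
    using G.group_derived_group[THEN group.is_monoid, THEN monoid.one_closed] by simp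
  moreover have "comm G x y \<in> derived G (carrier G)"
    using assms by (simp add: G.comm_in_derived)
  ultimately have "comm G x y = \<one>\<^bsub>G\<^esub> \<longleftrightarrow> comm H u v = \<one>\<^bsub>H\<^esub>"
    using comm by (metis inj_onD)
  then show ?thesis
    using assms by (simp add: G.comm_eq_one_iff H.comm_eq_one_iff)
qed

text \<open>The map \<pi> labels the central cosets of \<open>H\<close> bijectively, and
  \<open>F\<close> records which labels commute. Pulling \<pi> back along \<theta> labels
  \<open>G\<close>: the fibres are the central cosets of \<open>G\<close>, hence all of the size of
  the centre, and the commutation pattern is still \<open>F\<close>.\<close>

lemma isoclinic_transport:
  fixes G :: "('a, 'b) monoid_scheme" and H :: "('c, 'd) monoid_scheme"
    and \<pi> :: "'c \<Rightarrow> 'l" and F :: "'l \<Rightarrow> 'l \<Rightarrow> bool"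
  assumes G: "group G" and H: "group H" and iso: "isoclinic G H"
    and \<pi>_commute: "\<And>u v. u \<in> carrier H \<Longrightarrow> v \<in> carrier H \<Longrightarrow>
      u \<otimes>\<^bsub>H\<^esub> v = v \<otimes>\<^bsub>H\<^esub> u \<longleftrightarrow> F (\<pi> u) (\<pi> v)"
    and \<pi>_coset: "\<And>u v. u \<in> carrier H \<Longrightarrow> v \<in> carrier H \<Longrightarrow>
      \<pi> u = \<pi> v \<longleftrightarrow> center H #>\<^bsub>H\<^esub> u = center H #>\<^bsub>H\<^esub> v"
    and \<pi>_surj: "\<pi> ` carrier H = UNIV"
  shows "\<exists>\<sigma>. (\<forall>x \<in> carrier G. \<forall>y \<in> carrier G.
      x \<otimes>\<^bsub>G\<^esub> y = y \<otimes>\<^bsub>G\<^esub> x \<longleftrightarrow> F (\<sigma> x) (\<sigma> y)) \<and>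
    (\<forall>c. card {x \<in> carrier G. \<sigma> x = c} = card (center G))"
proof -
  interpret G: group G by fact
  interpret H: group H by fact
  obtain \<theta> \<phi> where \<theta>: "\<theta> \<in> iso (G Mod center G) (H Mod center H)"
    and \<phi>: "\<phi> \<in> iso (derived_group G) (derived_group H)"
    and comm: "\<And>x y u v. \<lbrakk>x \<in> carrier G; y \<in> carrier G; u \<in> carrier H; v \<in> carrier H;
      \<theta> (center G #>\<^bsub>G\<^esub> x) = center H #>\<^bsub>H\<^esub> u; \<theta> (center G #>\<^bsub>G\<^esub> y) = center H #>\<^bsub>H\<^esub> v\<rbrakk>
      \<Longrightarrow> \<phi> (comm G x y) = comm H u v"
    using iso unfolding isoclinic_def by blast
  have bij: "bij_betw \<theta> (rcosets\<^bsub>G\<^esub> center G) (rcosets\<^bsub>H\<^esub> center H)"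
    using \<theta> by (simp add: iso_def FactGroup_def)
  have coset_mem: "center G #>\<^bsub>G\<^esub> x \<in> rcosets\<^bsub>G\<^esub> center G" if "x \<in> carrier G" for x
    using that by (auto simp: RCOSETS_def)
  have "\<exists>u \<in> carrier H. \<theta> (center G #>\<^bsub>G\<^esub> x) = center H #>\<^bsub>H\<^esub> u" if "x \<in> carrier G" for x
    using bij_betwE[OF bij] coset_mem[OF that] by (auto simp: RCOSETS_def)
  \<comment> \<open>An arbitrary representative of the image coset is enough, because both \<pi> and
    commutation depend only on the coset.\<close>
  then obtain \<tau> where \<tau>: "\<tau> x \<in> carrier H" "\<theta> (center G #>\<^bsub>G\<^esub> x) = center H #>\<^bsub>H\<^esub> \<tau> x"
    if "x \<in> carrier G" for x
    by metis
  have commute: "x \<otimes>\<^bsub>G\<^esub> y = y \<otimes>\<^bsub>G\<^esub> x \<longleftrightarrow> F (\<pi> (\<tau> x)) (\<pi> (\<tau> y))"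
    if "x \<in> carrier G" "y \<in> carrier G" for x y
    unfolding isoclinic_commute_iff[OF G H \<phi> comm[OF that \<tau>(1)[OF that(1)] \<tau>(1)[OF that(2)]
        \<tau>(2)[OF that(1)] \<tau>(2)[OF that(2)]] that \<tau>(1)[OF that(1)] \<tau>(1)[OF that(2)]]
    by (rule \<pi>_commute[OF \<tau>(1)[OF that(1)] \<tau>(1)[OF that(2)]])
  have "card {x \<in> carrier G. \<pi> (\<tau> x) = c} = card (center G)" for c
  proof -
    have "c \<in> \<pi> ` carrier H"
      using \<pi>_surj by simp
    then obtain u where u: "u \<in> carrier H" "\<pi> u = c"
      by blast
    then have "center H #>\<^bsub>H\<^esub> u \<in> rcosets\<^bsub>H\<^esub> center H"
      by (auto simp: RCOSETS_def)
    then have "center H #>\<^bsub>H\<^esub> u \<in> \<theta> ` (rcosets\<^bsub>G\<^esub> center G)"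
      using bij by (simp add: bij_betw_def)
    then obtain g where g: "g \<in> carrier G" "\<theta> (center G #>\<^bsub>G\<^esub> g) = center H #>\<^bsub>H\<^esub> u"
      unfolding RCOSETS_def by auto
    \<comment> \<open>The fibre over \<open>c\<close> is the single coset that \<theta> sends to the
      coset labelled \<open>c\<close>.\<close>
    have "\<pi> (\<tau> x) = c \<longleftrightarrow> x \<in> center G #>\<^bsub>G\<^esub> g" if "x \<in> carrier G" for x
    proof -
      have "\<pi> (\<tau> x) = c \<longleftrightarrow> center H #>\<^bsub>H\<^esub> \<tau> x = center H #>\<^bsub>H\<^esub> u"
        using \<pi>_coset[OF \<tau>(1)[OF that] u(1)] u(2) by simp
      also have "\<dots> \<longleftrightarrow> \<theta> (center G #>\<^bsub>G\<^esub> x) = \<theta> (center G #>\<^bsub>G\<^esub> g)"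
        using \<tau> that g by simp
      also have "\<dots> \<longleftrightarrow> center G #>\<^bsub>G\<^esub> x = center G #>\<^bsub>G\<^esub> g"
        using inj_on_eq_iff[OF bij_betw_imp_inj_on[OF bij] coset_mem[OF that] coset_mem[OF g(1)]]
        by simp
      also have "\<dots> \<longleftrightarrow> x \<in> center G #>\<^bsub>G\<^esub> g"
        using G.repr_independence[OF _ g(1) G.subgroup_center, of x]
          G.repr_independenceD[OF G.subgroup_center that, of g] by auto
      finally show ?thesis .
    qed
    moreover have "center G #>\<^bsub>G\<^esub> g \<subseteq> carrier G"
      using g G.r_coset_subset_G subgroup.subset[OF G.subgroup_center] by simp
    ultimately have "{x \<in> carrier G. \<pi> (\<tau> x) = c} = center G #>\<^bsub>G\<^esub> g"
      by blast
    then show ?thesis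
      using G.card_rcosets_equal[OF coset_mem[OF g(1)]] subgroup.subset[OF G.subgroup_center]
      by simp
  qed
  with commute show ?thesis
    by (intro exI[of _ "\<lambda>x. \<pi> (\<tau> x)"] conjI ballI allI)
qed

section \<open>The group $\Gamma_4 a_2$\<close>

text \<open>The word problem is solved by the normal form
  \<open>\<alpha>\<^sub>1\<^bsup>i\<^esup> \<alpha>\<^sub>2\<^bsup>j\<^esup> \<beta>\<^bsup>k\<^esup>\<close>: the exponents \<open>i\<close> and \<open>j\<close>, as computed by moving every \<open>\<beta>\<close> to the
  right, are determined modulo 4.\<close>

fun exponent :: "gen \<Rightarrow> gen word \<Rightarrow> int" where
  "exponent x [] = 0"
| "exponent x ((y, s) # w) = (if y = Beta then - exponent x w
     else (if y = x then (if s then 1 else -1) else 0) + exponent x w)"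

text \<open>The parity of the number of \<beta>-letters; the sign of such a letter is ignored
  because \<beta> is its own inverse.\<close>

fun flips :: "gen word \<Rightarrow> bool" where
  "flips [] = False"
| "flips ((y, s) # w) = ((y = Beta) \<noteq> flips w)"

text \<open>This is the multiplication rule of a semidirect product in which \<beta> acts by
  inversion.\<close>

lemma exponent_append:
  "exponent x (v @ w) = exponent x v + (if flips v then - exponent x w else exponent x w)"
  by (induction v) auto

lemma flips_append: "flips (v @ w) = (flips v \<noteq> flips w)"
  by (induction v) auto

text \<open>Each defining relation and each cancellation respects the invariants. This is the half
  of the word problem showing that the presentation does not collapse.\<close>

lemma pres_eq_invariants:
  "pres_eq Gamma4a2_rels v w \<Longrightarrow> flips v = flips w \<and> 4 dvd exponent x v - exponent x w"
proof (induction rule: pres_eq.induct)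
  case (pres_sym v w)
  then show ?case by (metis dvd_diff_commute)
next
  case (pres_trans u v w)
  then have "4 dvd (exponent x u - exponent x v) + (exponent x v - exponent x w)"
    by (blast intro: dvd_add)
  with pres_trans show ?case by simp
next
  case (pres_rel l r u v)
  moreover have "replicate 4 y = [y, y, y, y]" "replicate 2 y = [y, y]" for y :: "gen \<times> bool"
    by (simp_all add: eval_nat_numeral)
  ultimately show ?case
    by (auto simp: Gamma4a2_rels_def exponent_append flips_append)
qed (auto simp: exponent_append flips_append)

section \<open>Moving an element past a power\<close>

lemma (in group) conj_int_pow:
  assumes a: "a \<in> carrier G" and b: "b \<in> carrier G"
  shows "b \<otimes> a [^] (n::int) = (b \<otimes> a \<otimes> inv b) [^] n \<otimes> b"
proof -
  have "(\<lambda>x. b \<otimes> x \<otimes> inv b) \<in> hom G G"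
  proof (rule homI)
    fix x y assume xy: "x \<in> carrier G" "y \<in> carrier G"
    then have "inv b \<otimes> (b \<otimes> (y \<otimes> inv b)) = y \<otimes> inv b"
      using b by (simp flip: m_assoc)
    then show "b \<otimes> (x \<otimes> y) \<otimes> inv b = (b \<otimes> x \<otimes> inv b) \<otimes> (b \<otimes> y \<otimes> inv b)"
      using xy b by (simp add: m_assoc)
  qed (use b in simp)
  then have "b \<otimes> a [^] n \<otimes> inv b = (b \<otimes> a \<otimes> inv b) [^] n"
    using hom_int_pow[of "\<lambda>x. b \<otimes> x \<otimes> inv b" G G a n] a is_group by blast
  then have "(b \<otimes> a [^] n \<otimes> inv b) \<otimes> b = (b \<otimes> a \<otimes> inv b) [^] n \<otimes> b"
    by (rule arg_cong)
  then show ?thesis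
    using a b by (simp add: m_assoc)
qed

text \<open>The rule by which \<beta> moves to the right past a power of \<alpha>1 or
  \<alpha>2.\<close>

lemma (in group) inverting_int_pow:
  assumes "a \<in> carrier G" "b \<in> carrier G" "b \<otimes> a \<otimes> inv b = inv a"
  shows "b \<otimes> a [^] (n::int) = a [^] (- n) \<otimes> b"
  using conj_int_pow[OF assms(1,2)] assms by (simp add: int_pow_inv int_pow_neg)

lemma (in group) commute_int_pow:
  assumes "a \<in> carrier G" "c \<in> carrier G" "a \<otimes> c = c \<otimes> a"
  shows "c \<otimes> a [^] (n::int) = a [^] n \<otimes> c"
proof -
  have "c \<otimes> a \<otimes> inv c = a \<otimes> c \<otimes> inv c"
    using assms(3) by (simp only:)
  also have "\<dots> = a"
    using assms(1,2) by (simp add: m_assoc)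
  finally show ?thesis
    using conj_int_pow[OF assms(1,2)] by (simp only:)
qed

lemma (in group) int_pow_eq_of_dvd:
  assumes "a \<in> carrier G" "a [^] (k::int) = \<one>" "k dvd m - n"
  shows "a [^] m = a [^] n"
proof -
  obtain q where "m = k * q + n"
    using assms(3) by (metis dvdE diff_eq_eq)
  then show ?thesis
    using assms(1,2) by (simp add: int_pow_mult flip: int_pow_pow)
qed

section \<open>Normal form and word problem\<close>

abbreviation "Gamma4a2_elt \<equiv> pres_class Gamma4a2_rels"

lemma group_Gamma4a2: "group Gamma4a2"
  unfolding Gamma4a2_def by (rule group_presented_group)

lemma carrier_Gamma4a2: "carrier Gamma4a2 = range Gamma4a2_elt"
  by (simp add: Gamma4a2_def presented_group_def)

lemma one_Gamma4a2: "\<one>\<^bsub>Gamma4a2\<^esub> = Gamma4a2_elt []"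
  by (simp add: Gamma4a2_def presented_group_def)

lemma mult_Gamma4a2: "Gamma4a2_elt v \<otimes>\<^bsub>Gamma4a2\<^esub> Gamma4a2_elt w = Gamma4a2_elt (v @ w)"
  unfolding Gamma4a2_def by (rule presented_group_mult)

lemma inv_letter_Gamma4a2: "inv\<^bsub>Gamma4a2\<^esub> Gamma4a2_elt [(x, b)] = Gamma4a2_elt [(x, \<not> b)]"
proof -
  interpret group Gamma4a2 by (rule group_Gamma4a2)
  show ?thesis
    using pres_eq.pres_cancel[of Gamma4a2_rels "[]" x "\<not> b" "[]"]
    by (intro inv_equality)
      (auto simp: carrier_Gamma4a2 mult_Gamma4a2 one_Gamma4a2 pres_class_eq_iff)
qed

lemma rel_Gamma4a2: "(l, r) \<in> Gamma4a2_rels \<Longrightarrow> Gamma4a2_elt l = Gamma4a2_elt r"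
  using pres_eq.pres_rel[of l r Gamma4a2_rels "[]" "[]"] by (simp add: pres_class_eq_iff)

lemma Gamma4a2_generators:
  fixes a c b
  defines "a \<equiv> Gamma4a2_elt [pos Alpha1]" and "c \<equiv> Gamma4a2_elt [pos Alpha2]"
    and "b \<equiv> Gamma4a2_elt [pos Beta]"
  shows "a [^]\<^bsub>Gamma4a2\<^esub> (4::int) = \<one>\<^bsub>Gamma4a2\<^esub>" "c [^]\<^bsub>Gamma4a2\<^esub> (4::int) = \<one>\<^bsub>Gamma4a2\<^esub>"
    "b \<otimes>\<^bsub>Gamma4a2\<^esub> b = \<one>\<^bsub>Gamma4a2\<^esub>" "a \<otimes>\<^bsub>Gamma4a2\<^esub> c = c \<otimes>\<^bsub>Gamma4a2\<^esub> a"
    "b \<otimes>\<^bsub>Gamma4a2\<^esub> a \<otimes>\<^bsub>Gamma4a2\<^esub> inv\<^bsub>Gamma4a2\<^esub> b = inv\<^bsub>Gamma4a2\<^esub> a"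
    "b \<otimes>\<^bsub>Gamma4a2\<^esub> c \<otimes>\<^bsub>Gamma4a2\<^esub> inv\<^bsub>Gamma4a2\<^esub> b = inv\<^bsub>Gamma4a2\<^esub> c"
proof -
  interpret group Gamma4a2 by (rule group_Gamma4a2)
  have pow4: "Gamma4a2_elt [x] [^]\<^bsub>Gamma4a2\<^esub> (4::int) = Gamma4a2_elt (replicate 4 x)" for x
    using int_pow_int[of Gamma4a2 "Gamma4a2_elt [x]" 4]
    by (simp add: numeral_eq_Suc mult_Gamma4a2 one_Gamma4a2)
  have rels: "Gamma4a2_elt (replicate 4 (pos Alpha1)) = Gamma4a2_elt []"
    "Gamma4a2_elt (replicate 4 (pos Alpha2)) = Gamma4a2_elt []"
    "Gamma4a2_elt (replicate 2 (pos Beta)) = Gamma4a2_elt []"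
    "Gamma4a2_elt [pos Beta, pos Alpha1, neg Beta] = Gamma4a2_elt [neg Alpha1]"
    "Gamma4a2_elt [pos Beta, pos Alpha2, neg Beta] = Gamma4a2_elt [neg Alpha2]"
    "Gamma4a2_elt [pos Alpha1, pos Alpha2] = Gamma4a2_elt [pos Alpha2, pos Alpha1]"
    by (rule rel_Gamma4a2, simp add: Gamma4a2_rels_def)+
  show "a [^]\<^bsub>Gamma4a2\<^esub> (4::int) = \<one>\<^bsub>Gamma4a2\<^esub>" "c [^]\<^bsub>Gamma4a2\<^esub> (4::int) = \<one>\<^bsub>Gamma4a2\<^esub>"
    by (simp_all only: a_def c_def pow4 rels one_Gamma4a2)
  show "b \<otimes>\<^bsub>Gamma4a2\<^esub> b = \<one>\<^bsub>Gamma4a2\<^esub>"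
    using rels(3) by (simp add: b_def mult_Gamma4a2 one_Gamma4a2 numeral_2_eq_2)
  show "a \<otimes>\<^bsub>Gamma4a2\<^esub> c = c \<otimes>\<^bsub>Gamma4a2\<^esub> a"
    "b \<otimes>\<^bsub>Gamma4a2\<^esub> a \<otimes>\<^bsub>Gamma4a2\<^esub> inv\<^bsub>Gamma4a2\<^esub> b = inv\<^bsub>Gamma4a2\<^esub> a"
    "b \<otimes>\<^bsub>Gamma4a2\<^esub> c \<otimes>\<^bsub>Gamma4a2\<^esub> inv\<^bsub>Gamma4a2\<^esub> b = inv\<^bsub>Gamma4a2\<^esub> c"
    using rels by (simp_all add: a_def b_def c_def mult_Gamma4a2 inv_letter_Gamma4a2)
qed

text \<open>By induction on the word, the new first letter is moved to its place: \<alpha>1 merges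
  with the first power, \<alpha>2 commutes past that power, and \<beta> inverts both powers. The
  recursion of \<open>exponent\<close> mirrors these moves.\<close>

lemma Gamma4a2_normal_form:
  "Gamma4a2_elt w =
    Gamma4a2_elt [pos Alpha1] [^]\<^bsub>Gamma4a2\<^esub> exponent Alpha1 w \<otimes>\<^bsub>Gamma4a2\<^esub>
    (Gamma4a2_elt [pos Alpha2] [^]\<^bsub>Gamma4a2\<^esub> exponent Alpha2 w \<otimes>\<^bsub>Gamma4a2\<^esub>
    (if flips w then Gamma4a2_elt [pos Beta] else \<one>\<^bsub>Gamma4a2\<^esub>))"
proof (induction w)
  case Nil
  interpret group Gamma4a2 by (rule group_Gamma4a2)
  show ?case by (simp flip: one_Gamma4a2)
next
  case (Cons l w)
  interpret group Gamma4a2 by (rule group_Gamma4a2)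
  define a c b where "a = Gamma4a2_elt [pos Alpha1]" and "c = Gamma4a2_elt [pos Alpha2]"
    and "b = Gamma4a2_elt [pos Beta]"
  note defs = a_def c_def b_def
  have [simp]: "a \<in> carrier Gamma4a2" "c \<in> carrier Gamma4a2" "b \<in> carrier Gamma4a2"
    by (auto simp: defs carrier_Gamma4a2)
  note gens = Gamma4a2_generators[folded defs]
  obtain y s where l: "l = (y, s)" by (cases l)
  let ?i = "exponent Alpha1 w" and ?j = "exponent Alpha2 w"
  define t where "t = (if flips w then b else \<one>\<^bsub>Gamma4a2\<^esub>)"
  have [simp]: "t \<in> carrier Gamma4a2"
    by (simp add: t_def)
  have "Gamma4a2_elt (l # w) = Gamma4a2_elt [l] \<otimes>\<^bsub>Gamma4a2\<^esub> Gamma4a2_elt w"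
    by (simp add: mult_Gamma4a2)
  also have "Gamma4a2_elt w = a [^]\<^bsub>Gamma4a2\<^esub> ?i \<otimes>\<^bsub>Gamma4a2\<^esub> (c [^]\<^bsub>Gamma4a2\<^esub> ?j \<otimes>\<^bsub>Gamma4a2\<^esub> t)"
    unfolding t_def defs by (rule Cons.IH)
  finally have lw: "Gamma4a2_elt (l # w)
    = Gamma4a2_elt [l] \<otimes>\<^bsub>Gamma4a2\<^esub> (a [^]\<^bsub>Gamma4a2\<^esub> ?i \<otimes>\<^bsub>Gamma4a2\<^esub> (c [^]\<^bsub>Gamma4a2\<^esub> ?j \<otimes>\<^bsub>Gamma4a2\<^esub> t))" .
  have letter: "Gamma4a2_elt [l] = (if s then Gamma4a2_elt [pos y] else inv\<^bsub>Gamma4a2\<^esub> Gamma4a2_elt [pos y])"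
    by (simp add: l inv_letter_Gamma4a2)
  have letter_pow: "Gamma4a2_elt [l] = Gamma4a2_elt [pos y] [^]\<^bsub>Gamma4a2\<^esub> (if s then 1 else - 1 :: int)"
    unfolding letter by (simp add: int_pow_neg carrier_Gamma4a2)
  show ?case
  proof (cases y)
    case Alpha1
    then have "Gamma4a2_elt (l # w) = (a [^]\<^bsub>Gamma4a2\<^esub> (if s then 1 else - 1 :: int) \<otimes>\<^bsub>Gamma4a2\<^esub> a [^]\<^bsub>Gamma4a2\<^esub> ?i)
        \<otimes>\<^bsub>Gamma4a2\<^esub> (c [^]\<^bsub>Gamma4a2\<^esub> ?j \<otimes>\<^bsub>Gamma4a2\<^esub> t)"
      unfolding lw letter_pow a_def[symmetric] by (simp add: m_assoc flip: a_def)
    then show ?thesis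
      by (simp add: l Alpha1 t_def flip: defs int_pow_mult)
  next
    case Alpha2
    have "c [^]\<^bsub>Gamma4a2\<^esub> (if s then 1 else - 1 :: int) \<otimes>\<^bsub>Gamma4a2\<^esub> a [^]\<^bsub>Gamma4a2\<^esub> ?i
        = a [^]\<^bsub>Gamma4a2\<^esub> ?i \<otimes>\<^bsub>Gamma4a2\<^esub> c [^]\<^bsub>Gamma4a2\<^esub> (if s then 1 else - 1 :: int)"
      by (intro commute_int_pow commute_int_pow[symmetric]) (simp_all add: gens)
    then have "Gamma4a2_elt (l # w) = a [^]\<^bsub>Gamma4a2\<^esub> ?i \<otimes>\<^bsub>Gamma4a2\<^esub>
        ((c [^]\<^bsub>Gamma4a2\<^esub> (if s then 1 else - 1 :: int) \<otimes>\<^bsub>Gamma4a2\<^esub> c [^]\<^bsub>Gamma4a2\<^esub> ?j) \<otimes>\<^bsub>Gamma4a2\<^esub> t)"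
      unfolding lw letter_pow Alpha2 c_def[symmetric]
      by (simp add: m_assoc flip: m_assoc[of _ "a [^]\<^bsub>Gamma4a2\<^esub> ?i"])
    then show ?thesis
      by (simp add: l Alpha2 t_def flip: defs int_pow_mult)
  next
    case Beta
    \<comment> \<open>Both signs of the letter thus give the same element, as in the definitions of
      \<open>exponent\<close> and \<open>flips\<close>.\<close>
    have inv_b: "inv\<^bsub>Gamma4a2\<^esub> b = b"
      using gens(3) by (simp add: inv_equality)
    have "Gamma4a2_elt (l # w) = b \<otimes>\<^bsub>Gamma4a2\<^esub>
        (a [^]\<^bsub>Gamma4a2\<^esub> ?i \<otimes>\<^bsub>Gamma4a2\<^esub> (c [^]\<^bsub>Gamma4a2\<^esub> ?j \<otimes>\<^bsub>Gamma4a2\<^esub> t))"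
      unfolding lw letter Beta b_def[symmetric] by (simp add: inv_b)
    also have "\<dots> = (b \<otimes>\<^bsub>Gamma4a2\<^esub> a [^]\<^bsub>Gamma4a2\<^esub> ?i) \<otimes>\<^bsub>Gamma4a2\<^esub> (c [^]\<^bsub>Gamma4a2\<^esub> ?j \<otimes>\<^bsub>Gamma4a2\<^esub> t)"
      by (simp add: m_assoc)
    also have "\<dots> = a [^]\<^bsub>Gamma4a2\<^esub> (- ?i) \<otimes>\<^bsub>Gamma4a2\<^esub> ((b \<otimes>\<^bsub>Gamma4a2\<^esub> c [^]\<^bsub>Gamma4a2\<^esub> ?j) \<otimes>\<^bsub>Gamma4a2\<^esub> t)"
      by (subst inverting_int_pow) (simp_all add: gens m_assoc)
    also have "\<dots> = a [^]\<^bsub>Gamma4a2\<^esub> (- ?i) \<otimes>\<^bsub>Gamma4a2\<^esub> (c [^]\<^bsub>Gamma4a2\<^esub> (- ?j) \<otimes>\<^bsub>Gamma4a2\<^esub> (b \<otimes>\<^bsub>Gamma4a2\<^esub> t))"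
      by (subst inverting_int_pow) (simp_all add: gens m_assoc)
    finally show ?thesis
      by (simp add: l Beta t_def gens flip: defs)
  qed
qed

text \<open>Equal elements have equal invariants by \<open>pres_eq_invariants\<close>; conversely
  the invariants determine the normal form, since \<alpha>1 and \<alpha>2 have trivial fourth
  power.\<close>

lemma Gamma4a2_elt_eq_iff:
  "Gamma4a2_elt v = Gamma4a2_elt w \<longleftrightarrow> flips v = flips w \<and>
    4 dvd exponent Alpha1 v - exponent Alpha1 w \<and> 4 dvd exponent Alpha2 v - exponent Alpha2 w"
proof
  interpret group Gamma4a2 by (rule group_Gamma4a2)
  assume eq: "flips v = flips w \<and>
    4 dvd exponent Alpha1 v - exponent Alpha1 w \<and> 4 dvd exponent Alpha2 v - exponent Alpha2 w"
  have "Gamma4a2_elt [pos Alpha1] [^]\<^bsub>Gamma4a2\<^esub> exponent Alpha1 v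
      = Gamma4a2_elt [pos Alpha1] [^]\<^bsub>Gamma4a2\<^esub> exponent Alpha1 w"
    using eq Gamma4a2_generators(1) by (intro int_pow_eq_of_dvd[of _ 4]) (auto simp: carrier_Gamma4a2)
  moreover have "Gamma4a2_elt [pos Alpha2] [^]\<^bsub>Gamma4a2\<^esub> exponent Alpha2 v
      = Gamma4a2_elt [pos Alpha2] [^]\<^bsub>Gamma4a2\<^esub> exponent Alpha2 w"
    using eq Gamma4a2_generators(2) by (intro int_pow_eq_of_dvd[of _ 4]) (auto simp: carrier_Gamma4a2)
  ultimately show "Gamma4a2_elt v = Gamma4a2_elt w"
    using eq by (subst (1 2) Gamma4a2_normal_form) simp
qed (simp add: pres_class_eq_iff pres_eq_invariants)

text \<open>The image of an element in the central quotient, an elementary abelian group of order 8.\<close>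

type_synonym label = "bool \<times> bool \<times> bool"

definition word_label :: "gen word \<Rightarrow> label" where
  "word_label w = (odd (exponent Alpha1 w), odd (exponent Alpha2 w), flips w)"

definition Gamma4_label :: "gen word set \<Rightarrow> label" where
  "Gamma4_label X = word_label (SOME w. X = Gamma4a2_elt w)"

fun label_commute :: "label \<Rightarrow> label \<Rightarrow> bool" where
  "label_commute (i, j, k) (i', j', k') \<longleftrightarrow> (i \<and> k') = (i' \<and> k) \<and> (j \<and> k') = (j' \<and> k)"

text \<open>The choice of a representing word is harmless: exponents determined modulo 4 have
  determined parities.\<close>

lemma Gamma4_label_elt: "Gamma4_label (Gamma4a2_elt w) = word_label w"
proof -
  define v where "v = (SOME v. Gamma4a2_elt w = Gamma4a2_elt v)"
  have "Gamma4a2_elt w = Gamma4a2_elt v"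
    unfolding v_def by (rule someI) (rule refl)
  then have fl: "flips w = flips v" and "4 dvd exponent Alpha1 w - exponent Alpha1 v"
    "4 dvd exponent Alpha2 w - exponent Alpha2 v"
    by (simp_all add: Gamma4a2_elt_eq_iff)
  then have "even (exponent Alpha1 w - exponent Alpha1 v)" "even (exponent Alpha2 w - exponent Alpha2 v)"
    by (simp_all only: dvd_trans[of 2 "4::int"] even_numeral)
  with fl show ?thesis
    by (auto simp: Gamma4_label_def word_label_def simp flip: v_def)
qed

text \<open>Here \<open>x\<close> and \<open>y\<close> are exponents of two words with flips
  \<open>k\<close> and \<open>l\<close>, and the difference compares the two orders of
  concatenation. It reduces to \<open>2 * x\<close> if \<open>l\<close> holds, minus
  \<open>2 * y\<close> if \<open>k\<close> holds.\<close>

lemma commutator_parity: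
  fixes x y :: int
  shows "4 dvd (x + (if k then - y else y)) - (y + (if l then - x else x)) \<longleftrightarrow>
    (odd x \<and> l) = (odd y \<and> k)"
  by (cases k; cases l; simp; presburger)

lemma Gamma4_label_commute:
  assumes "X \<in> carrier Gamma4a2" "Y \<in> carrier Gamma4a2"
  shows "X \<otimes>\<^bsub>Gamma4a2\<^esub> Y = Y \<otimes>\<^bsub>Gamma4a2\<^esub> X \<longleftrightarrow> label_commute (Gamma4_label X) (Gamma4_label Y)"
proof -
  obtain v w where "X = Gamma4a2_elt v" "Y = Gamma4a2_elt w"
    using assms by (auto simp: carrier_Gamma4a2)
  then show ?thesis
    by (simp only: mult_Gamma4a2 Gamma4a2_elt_eq_iff Gamma4_label_elt word_label_def
        label_commute.simps exponent_append flips_append commutator_parity) auto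
qed

text \<open>Signs do not affect parity, so the label is a homomorphism to the elementary abelian
  group, where \<open>\<noteq>\<close> is addition modulo 2.\<close>

lemma Gamma4_label_mult:
  assumes "X \<in> carrier Gamma4a2" "Y \<in> carrier Gamma4a2"
    and "Gamma4_label X = (i, j, k)" "Gamma4_label Y = (i', j', k')"
  shows "Gamma4_label (X \<otimes>\<^bsub>Gamma4a2\<^esub> Y) = (i \<noteq> i', j \<noteq> j', k \<noteq> k')"
proof -
  obtain v w where "X = Gamma4a2_elt v" "Y = Gamma4a2_elt w"
    using assms by (auto simp: carrier_Gamma4a2)
  then show ?thesis
    using assms
    by (auto simp: mult_Gamma4a2 Gamma4_label_elt word_label_def exponent_append flips_append)
qed

lemma Gamma4_label_surj: "Gamma4_label ` carrier Gamma4a2 = UNIV"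
proof -
  have "(i, j, k) \<in> Gamma4_label ` carrier Gamma4a2" for i j k
  proof -
    let ?w = "(if i then [pos Alpha1] else []) @ (if j then [pos Alpha2] else [])
      @ (if k then [pos Beta] else [])"
    have "Gamma4_label (Gamma4a2_elt ?w) = (i, j, k)"
      unfolding Gamma4_label_elt word_label_def by (cases i; cases j; cases k; simp)
    moreover have "Gamma4a2_elt ?w \<in> carrier Gamma4a2"
      unfolding carrier_Gamma4a2 by (rule rangeI)
    ultimately show ?thesis
      by (rule image_eqI[OF sym])
  qed
  then show ?thesis
    by auto
qed

text \<open>A label with \<open>i\<close> or \<open>j\<close> fails to commute with that of \<beta>,
  and one with \<open>k\<close> fails against \<alpha>1 or \<alpha>2 or both, according to
  \<open>i\<close> and \<open>j\<close>; only the zero label survives.\<close>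

lemma label_commute_all_iff: "(\<forall>d. label_commute c d) \<longleftrightarrow> c = (False, False, False)"
  by (cases c) auto

lemma Gamma4_label_center:
  assumes "X \<in> carrier Gamma4a2"
  shows "X \<in> center Gamma4a2 \<longleftrightarrow> Gamma4_label X = (False, False, False)"
proof -
  have "X \<in> center Gamma4a2 \<longleftrightarrow> (\<forall>Y \<in> carrier Gamma4a2. label_commute (Gamma4_label X) (Gamma4_label Y))"
    using assms by (simp add: center_def Gamma4_label_commute)
  also have "\<dots> \<longleftrightarrow> (\<forall>d \<in> Gamma4_label ` carrier Gamma4a2. label_commute (Gamma4_label X) d)"
    by blast
  finally show ?thesis
    unfolding Gamma4_label_surj ball_UNIV label_commute_all_iff .
qed

text \<open>Labels are additive and vanish exactly on the centre, so equal labels mean that the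
  quotient \<open>Z\<close> of \<open>X\<close> by \<open>Y\<close> is central.\<close>

lemma Gamma4_label_eq_iff:
  assumes X: "X \<in> carrier Gamma4a2" and Y: "Y \<in> carrier Gamma4a2"
  shows "Gamma4_label X = Gamma4_label Y \<longleftrightarrow>
    center Gamma4a2 #>\<^bsub>Gamma4a2\<^esub> X = center Gamma4a2 #>\<^bsub>Gamma4a2\<^esub> Y"
proof -
  interpret group Gamma4a2 by (rule group_Gamma4a2)
  define Z where "Z = X \<otimes>\<^bsub>Gamma4a2\<^esub> inv\<^bsub>Gamma4a2\<^esub> Y"
  have Z: "Z \<in> carrier Gamma4a2" and XZ: "X = Z \<otimes>\<^bsub>Gamma4a2\<^esub> Y"
    using X Y by (simp_all add: Z_def m_assoc)
  obtain i j k i' j' k' where lab: "Gamma4_label Z = (i, j, k)" "Gamma4_label Y = (i', j', k')"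
    by (metis prod_cases3)
  have "Gamma4_label X = Gamma4_label Y \<longleftrightarrow> Z \<in> center Gamma4a2"
    using Gamma4_label_mult[OF Z Y lab] lab by (auto simp: XZ Gamma4_label_center[OF Z])
  also have "\<dots> \<longleftrightarrow> X \<in> center Gamma4a2 #>\<^bsub>Gamma4a2\<^esub> Y"
    using X Y subgroup.rcos_module[OF subgroup_center is_group Y X] by (simp add: Z_def)
  also have "\<dots> \<longleftrightarrow> center Gamma4a2 #>\<^bsub>Gamma4a2\<^esub> X = center Gamma4a2 #>\<^bsub>Gamma4a2\<^esub> Y"
    using repr_independence repr_independenceD subgroup_center X Y by metis
  finally show ?thesis .
qed

section \<open>Counting in groups of the family $\Gamma_4$\<close>

lemma card_vimage_on:
  assumes "finite A" "finite S" and "\<And>c. card {x \<in> A. f x = c} = q"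
  shows "card {x \<in> A. f x \<in> S} = q * card S"
proof -
  have "{x \<in> A. f x \<in> S} = (\<Union>c \<in> S. {x \<in> A. f x = c})"
    by auto
  moreover have "card (\<Union>c \<in> S. {x \<in> A. f x = c}) = (\<Sum>c \<in> S. card {x \<in> A. f x = c})"
    using assms(1,2) by (intro card_UN_disjoint) auto
  ultimately show ?thesis
    using assms(3) by simp
qed

lemma sum_fibres:
  fixes h :: "'c::finite \<Rightarrow> 'd::comm_semiring_1"
  assumes "finite A" and "\<And>c. card {x \<in> A. f x = c} = q"
  shows "(\<Sum>x \<in> A. h (f x)) = of_nat q * (\<Sum>c \<in> UNIV. h c)"
proof -
  have "(\<Sum>x \<in> A. h (f x)) = (\<Sum>c \<in> UNIV. \<Sum>x | x \<in> A \<and> f x = c. h (f x))"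
    using assms(1) by (subst sum.group) auto
  also have "\<dots> = (\<Sum>c \<in> UNIV. of_nat q * h c)"
    using assms(2) by (intro sum.cong) auto
  finally show ?thesis
    by (simp add: sum_distrib_left)
qed

lemma UNIV_label: "(UNIV :: label set) = {False, True} \<times> {False, True} \<times> {False, True}"
  by auto

lemma card_UNIV_label: "card (UNIV :: label set) = 8"
  unfolding UNIV_label by (simp add: card_cartesian_product)

text \<open>A label involving \<beta> commutes only with zero and itself; a nonzero label without
  \<beta> commutes exactly with the labels without \<beta>.\<close>

lemma card_label_commute:
  "card {d. label_commute (i, j, k) d} = (if k then 2 else if i \<or> j then 4 else 8)"
proof -
  have "{d. label_commute (i, j, k) d} =
      (if k then {(False, False, False), (i, j, True)}
       else if i \<or> j then UNIV \<times> UNIV \<times> {False} else UNIV)"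
    by (auto split: if_splits)
  then show ?thesis
    by (simp add: card_UNIV_label card_cartesian_product)
qed

section \<open>Counting from labels with equal fibres\<close>

context group
begin

text \<open>From isoclinism only the labelling \<sigma> is retained; in the application
  \<open>q\<close> is the order of the centre of \<open>G\<close>.\<close>

context
  fixes \<sigma> :: "'a \<Rightarrow> label" and q :: nat
  assumes fin: "finite (carrier G)"
    and commute: "\<And>x y. x \<in> carrier G \<Longrightarrow> y \<in> carrier G \<Longrightarrow>
      x \<otimes> y = y \<otimes> x \<longleftrightarrow> label_commute (\<sigma> x) (\<sigma> y)"
    and fibre: "\<And>c. card {x \<in> carrier G. \<sigma> x = c} = q"
begin

lemma order_eq_fibre: "order G = 8 * q"
  using card_vimage_on[OF fin, of "UNIV :: label set" \<sigma> q] fibre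
  by (simp add: order_def card_UNIV_label)

text \<open>One label has centralizers of order \<open>8 * q\<close>, three have
  \<open>4 * q\<close> and four have \<open>2 * q\<close>, each label accounting for
  \<open>q\<close> elements. Multiplying by the group order keeps the identity in the
  naturals.\<close>

lemma alpha_eq:
  "alpha G n * (8 * q) = q * ((8 * q) ^ n + 3 * (4 * q) ^ n + 4 * (2 * q) ^ n)"
proof -
  have "card (centralizer G g) = q * card {d. label_commute (\<sigma> g) d}" if "g \<in> carrier G" for g
  proof -
    have "centralizer G g = {x \<in> carrier G. \<sigma> x \<in> {d. label_commute (\<sigma> g) d}}"
      using commute[OF that] by (auto simp only: centralizer_def mem_Collect_eq)
    then show ?thesis
      using card_vimage_on[OF fin _ fibre, of "{d. label_commute (\<sigma> g) d}"] by simp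
  qed
  then have "alpha G n * order G = (\<Sum>g \<in> carrier G. (q * card {d. label_commute (\<sigma> g) d}) ^ n)"
    by (simp add: alpha_times_order[OF fin])
  also have "\<dots> = q * (\<Sum>c \<in> UNIV. (q * card {d. label_commute c d}) ^ n)"
    using sum_fibres[OF fin fibre, of "\<lambda>c. (q * card {d. label_commute c d}) ^ n"] by simp
  also have "(\<Sum>c \<in> UNIV. (q * card {d. label_commute c d}) ^ n)
      = (8 * q) ^ n + 3 * (4 * q) ^ n + 4 * (2 * q) ^ n"
    by (simp add: UNIV_label sum.cartesian_product[symmetric] card_label_commute mult.commute)
  finally show ?thesis
    by (simp add: order_eq_fibre)
qed

text \<open>A commuting tuple lies in the abelian subgroup of index 2, or it has an entry outside that
  subgroup, whose coset \<open>c\<close> of the centre then contains every noncentral entry.\<close>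

lemma card_commuting_tuples:
  "card (commuting_tuples G n) + 4 * q ^ n = (4 * q) ^ n + 4 * (2 * q) ^ n"
proof -
  \<comment> \<open>All tuples with labels in \<open>S\<close>, whether commuting or not; their
    number depends only on the size of \<open>S\<close>.\<close>
  define T where "T S = {xs. set xs \<subseteq> {x \<in> carrier G. \<sigma> x \<in> S} \<and> length xs = n}" for S
  have card_T: "card (T S) = (q * card S) ^ n" for S
    unfolding T_def using fin card_vimage_on[OF fin _ fibre, of S]
    by (simp add: card_lists_length_eq)
  have finite_T: "finite (T S)" for S
    unfolding T_def using fin by (intro finite_lists_length_eq) simp
  have mem_T: "xs \<in> T S \<longleftrightarrow> xs \<in> tuples G n \<and> \<sigma> ` set xs \<subseteq> S" for xs S
    by (auto simp: T_def tuples_def)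
  have mem_comm: "xs \<in> commuting_tuples G n \<longleftrightarrow>
      xs \<in> tuples G n \<and> (\<forall>c \<in> \<sigma> ` set xs. \<forall>d \<in> \<sigma> ` set xs. label_commute c d)" for xs
    using commute by (auto simp: commuting_tuples_def tuples_def subset_iff)
  define z where "z = (False, False, False)"
  \<comment> \<open>The labels of the abelian subgroup of index 2.\<close>
  define A :: "label set" where "A = {(i, j, k). \<not> k}"
  have "A = {False, True} \<times> {False, True} \<times> {False}"
    by (auto simp: A_def)
  then have card_A: "card A = 4"
    by (simp add: card_cartesian_product)
  have lc: "label_commute c d \<longleftrightarrow> d = z \<or> d = c" if "c \<notin> A" for c d
    using that by (cases c; cases d) (auto simp: A_def z_def)
  have lcA: "label_commute c d" if "c \<in> A" "d \<in> A" for c d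
    using that by (auto simp: A_def)
  have zA: "z \<in> A" and lcz: "label_commute z c" for c
    by (cases c; simp add: z_def A_def)+
  have lc_refl: "label_commute c c" and lc_sym: "label_commute c d \<Longrightarrow> label_commute d c" for c d
    by (cases c; cases d; auto)+
  \<comment> \<open>Here \<open>L\<close> is the set of labels of a tuple. Excluding
    \<open>L \<subseteq> {z}\<close> drops the wholly central tuples, already counted under
    \<open>A\<close>, and makes the cases disjoint.\<close>
  have *: "(\<forall>c \<in> L. \<forall>d \<in> L. label_commute c d) \<longleftrightarrow>
      L \<subseteq> A \<or> (\<exists>c \<in> - A. L \<subseteq> {z, c} \<and> \<not> L \<subseteq> {z})" for L
  proof
    assume L: "\<forall>c \<in> L. \<forall>d \<in> L. label_commute c d"
    show "L \<subseteq> A \<or> (\<exists>c \<in> - A. L \<subseteq> {z, c} \<and> \<not> L \<subseteq> {z})"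
    proof (cases "L \<subseteq> A")
      case False
      then obtain c where c: "c \<in> L" "c \<notin> A"
        by blast
      then have "L \<subseteq> {z, c}" "c \<noteq> z"
        using L lc zA by blast+
      with c show ?thesis
        by blast
    qed simp
  next
    assume "L \<subseteq> A \<or> (\<exists>c \<in> - A. L \<subseteq> {z, c} \<and> \<not> L \<subseteq> {z})"
    then show "\<forall>c \<in> L. \<forall>d \<in> L. label_commute c d"
    proof
      assume "\<exists>c \<in> - A. L \<subseteq> {z, c} \<and> \<not> L \<subseteq> {z}"
      then obtain c where "L \<subseteq> {z, c}"
        by blast
      then show ?thesis
        using lcz lc_refl lc_sym by blast
    qed (use lcA in blast)
  qed
  have "commuting_tuples G n = T A \<union> (\<Union>c \<in> - A. T {z, c} - T {z})"
    by (rule Set.set_eqI) (simp only: Un_iff UN_iff Diff_iff mem_comm mem_T *, blast)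
  moreover have "T A \<inter> (\<Union>c \<in> - A. T {z, c} - T {z}) = {}"
    unfolding mem_T set_eq_iff Int_iff UN_iff Diff_iff by blast
  ultimately have "card (commuting_tuples G n) = card (T A) + card (\<Union>c \<in> - A. T {z, c} - T {z})"
    using finite_T by (simp add: card_Un_disjoint)
  also have "card (\<Union>c \<in> - A. T {z, c} - T {z}) = (\<Sum>c \<in> - A. card (T {z, c} - T {z}))"
  proof (rule card_UN_disjoint)
    show "\<forall>c \<in> - A. \<forall>d \<in> - A. c \<noteq> d \<longrightarrow> (T {z, c} - T {z}) \<inter> (T {z, d} - T {z}) = {}"
      unfolding mem_T set_eq_iff Int_iff UN_iff Diff_iff by blast
  qed (use finite_T in auto)
  also have "\<dots> = (\<Sum>c \<in> - A. (2 * q) ^ n - q ^ n)"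
  proof (rule sum.cong)
    fix c assume "c \<in> - A"
    then have "z \<noteq> c"
      using zA by blast
    then have "card {z, c} = 2"
      by simp
    moreover have "T {z} \<subseteq> T {z, c}"
      by (auto simp: T_def)
    ultimately show "card (T {z, c} - T {z}) = (2 * q) ^ n - q ^ n"
      using finite_T by (simp add: card_Diff_subset card_T mult.commute)
  qed simp
  also have "card (- A) = 4"
  proof -
    have "- A = {False, True} \<times> {False, True} \<times> {True}"
      by (auto simp: A_def)
    then show ?thesis by (simp add: card_cartesian_product)
  qed
  then have "(\<Sum>c \<in> - A. (2 * q) ^ n - q ^ n) = 4 * ((2 * q) ^ n - q ^ n)"
    by simp
  also have "card (T A) = (4 * q) ^ n"
    by (simp only: card_T card_A mult.commute)
  finally have "card (commuting_tuples G n) = (4 * q) ^ n + 4 * ((2 * q) ^ n - q ^ n)" .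
  \<comment> \<open>The truncated subtraction is therefore exact and may be moved to the other
    side.\<close>
  moreover have "q ^ n \<le> (2 * q) ^ n"
    by (simp add: power_mono)
  ultimately show ?thesis
    by linarith
qed

text \<open>The exponents are \<open>Suc n\<close> because Burnside's lemma brings in commuting
  tuples with one more entry.\<close>

lemma beta_eq:
  "beta G n * (8 * q) + 4 * q ^ Suc n = (4 * q) ^ Suc n + 4 * (2 * q) ^ Suc n"
  using beta_times_order[OF fin, of n] card_commuting_tuples[of "Suc n"]
  by (simp add: order_eq_fibre)

end

end

section \<open>Generating functions\<close>

lemma fps_const_divide_linear:
  "fps_const a / (1 - fps_const c * fps_X) = Abs_fps (\<lambda>n. a * c ^ n)"
  for a c :: "'a :: field"
proof -
  \<comment> \<open>Multiplying the geometric series by the denominator cancels every coefficient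
    but the one of index 0.\<close>
  have "Abs_fps (\<lambda>n. a * c ^ n) * (1 - fps_const c * fps_X)
      = Abs_fps (\<lambda>n. a * c ^ n) - (fps_const c * Abs_fps (\<lambda>n. a * c ^ n)) * fps_X"
    by (simp add: algebra_simps)
  also have "\<dots> = fps_const a"
    by (rule fps_ext) (simp add: power_eq_if)
  finally have "Abs_fps (\<lambda>n. a * c ^ n) * (1 - fps_const c * fps_X) = fps_const a" .
  moreover have "1 - fps_const c * fps_X \<noteq> (0 :: 'a fps)"
    by (rule fps_nonzeroI[of _ 0]) simp
  ultimately show ?thesis
    by (metis nonzero_mult_div_cancel_right)
qed

theorem lemma5p14:
  fixes G :: "('a, 'b) monoid_scheme" and m :: nat
  assumes "group G"
    and "order G = 2 ^ m"
    and "isoclinism_rank G = 5"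
    and "in_Gamma4 G"
  shows "fps_compose (A_series G) (fps_const (1 / of_nat (order G)) * fps_X) =
      fps_const (1 - 1/2) / (1 - fps_const (1/2^2) * fps_X)
    + fps_const (1/2 - 1/2^3) / (1 - fps_const (1/2) * fps_X)
    + fps_const (1/2^3) / (1 - fps_X)
  \<and> fps_compose (B_series G) (fps_const (1 / of_nat (order G)) * fps_X) =
      fps_const (- (1/2)) / (1 - fps_const (1/2^3) * fps_X)
    + 1 / (1 - fps_const (1/2^2) * fps_X)
    + fps_const (1/2) / (1 - fps_const (1/2) * fps_X)"
proof -
  interpret group G by fact
  have fin: "finite (carrier G)"
    using assms(2) by (simp add: order_def card_ge_0_finite)
  have iso: "isoclinic G Gamma4a2"
    using assms(4) by (simp add: in_Gamma4_def)
  have "\<exists>\<sigma>. (\<forall>x \<in> carrier G. \<forall>y \<in> carrier G.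
      x \<otimes>\<^bsub>G\<^esub> y = y \<otimes>\<^bsub>G\<^esub> x \<longleftrightarrow> label_commute (\<sigma> x) (\<sigma> y)) \<and>
    (\<forall>c. card {x \<in> carrier G. \<sigma> x = c} = card (center G))"
    by (rule isoclinic_transport[OF assms(1) group_Gamma4a2 iso Gamma4_label_commute
        Gamma4_label_eq_iff Gamma4_label_surj])
  then obtain \<sigma> where
    comm: "\<And>x y. x \<in> carrier G \<Longrightarrow> y \<in> carrier G \<Longrightarrow>
      x \<otimes>\<^bsub>G\<^esub> y = y \<otimes>\<^bsub>G\<^esub> x \<longleftrightarrow> label_commute (\<sigma> x) (\<sigma> y)"
    and fibre: "\<And>c. card {x \<in> carrier G. \<sigma> x = c} = card (center G)"
    by blast
  define q where "q = card (center G)"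
  note fibre = fibre[folded q_def]
  have ord: "order G = 8 * q"
    by (rule order_eq_fibre[OF fin comm fibre])
  have q: "q > 0"
    using ord assms(2) by (cases q) simp_all
  \<comment> \<open>The group order as a rational number; substituting \<open>t/|G|\<close> divides
    the coefficient of index \<open>n\<close> by \<open>Q ^ n\<close>.\<close>
  define Q where "Q = rat_of_nat (8 * q)"
  have Q: "Q \<noteq> 0"
    using q by (simp add: Q_def)
  have rat_q: "rat_of_nat (8 * q) = Q" "rat_of_nat (4 * q) = Q * (1/2)"
    "rat_of_nat (2 * q) = Q * (1/4)" "rat_of_nat q = Q * (1/8)"
    by (simp_all add: Q_def)
  have A: "(1 / rat_of_nat (order G)) ^ n * rat_of_nat (alpha G n)
      = 1/8 + 3/8 * (1/2) ^ n + 1/2 * (1/4) ^ n" for n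
  proof -
    have "rat_of_nat (alpha G n * (8 * q)) =
        rat_of_nat (q * ((8 * q) ^ n + 3 * (4 * q) ^ n + 4 * (2 * q) ^ n))"
      by (simp only: alpha_eq[OF fin comm fibre])
    then have "of_nat (alpha G n) * Q
        = Q * (1/8) * (Q ^ n + 3 * (Q * (1/2)) ^ n + 4 * (Q * (1/4)) ^ n)"
      by (simp only: of_nat_mult[of "alpha G n"] of_nat_mult[of q "_ + _"] of_nat_add of_nat_power
          of_nat_mult[of 3 "_ ^ _"] of_nat_mult[of 4 "_ ^ _"] of_nat_numeral rat_q)
    also have "\<dots> = (Q ^ n * (1/8 + 3/8 * (1/2) ^ n + 1/2 * (1/4) ^ n)) * Q"
      unfolding power_mult_distrib by (simp add: algebra_simps)
    finally have "of_nat (alpha G n) = Q ^ n * (1/8 + 3/8 * (1/2) ^ n + 1/2 * (1/4) ^ n)"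
      using Q by (simp only: mult_cancel_right) blast
    then show ?thesis
      using Q by (simp add: ord rat_q power_divide del: of_nat_mult)
  qed
  \<comment> \<open>The extra factor from \<open>Suc n\<close> turns the terms into multiples of
    \<open>n\<close>-th powers: \<open>4 * (1/4) ^ Suc n\<close> is \<open>(1/4) ^ n\<close> and
    \<open>4 * (1/8) ^ Suc n\<close> is \<open>1/2 * (1/8) ^ n\<close>.\<close>
  have B: "(1 / rat_of_nat (order G)) ^ n * rat_of_nat (beta G n)
      = 1/2 * (1/2) ^ n + (1/4) ^ n - 1/2 * (1/8) ^ n" for n
  proof -
    have "rat_of_nat (beta G n * (8 * q) + 4 * q ^ Suc n) =
        rat_of_nat ((4 * q) ^ Suc n + 4 * (2 * q) ^ Suc n)"
      by (simp only: beta_eq[OF fin comm fibre])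
    then have "of_nat (beta G n) * Q + 4 * (Q * (1/8)) ^ Suc n
        = (Q * (1/2)) ^ Suc n + 4 * (Q * (1/4)) ^ Suc n"
      by (simp only: of_nat_mult[of "beta G n"] of_nat_add of_nat_power
          of_nat_mult[of 4 "_ ^ _"] of_nat_numeral rat_q)
    then have "of_nat (beta G n) * Q = (Q ^ n * (1/2 * (1/2) ^ n + (1/4) ^ n - 1/2 * (1/8) ^ n)) * Q"
      unfolding power_mult_distrib power_Suc by (simp add: algebra_simps)
    then have "of_nat (beta G n) = Q ^ n * (1/2 * (1/2) ^ n + (1/4) ^ n - 1/2 * (1/8) ^ n)"
      using Q by (simp only: mult_cancel_right) blast
    then show ?thesis
      using Q by (simp add: ord rat_q power_divide del: of_nat_mult)
  qed
  \<comment> \<open>Gives the last denominator the shape required by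
    \<open>fps_const_divide_linear\<close>, with ratio 1.\<close>
  have X: "1 - fps_X = 1 - fps_const (1::rat) * fps_X"
    by simp
  show ?thesis
  proof
    show "fps_compose (A_series G) (fps_const (1 / of_nat (order G)) * fps_X) =
        fps_const (1 - 1/2) / (1 - fps_const (1/2^2) * fps_X)
      + fps_const (1/2 - 1/2^3) / (1 - fps_const (1/2) * fps_X)
      + fps_const (1/2^3) / (1 - fps_X)"
      unfolding X fps_const_divide_linear fps_compose_linear A_series_def
      by (rule fps_ext) (simp add: A)
    show "fps_compose (B_series G) (fps_const (1 / of_nat (order G)) * fps_X) =
        fps_const (- (1/2)) / (1 - fps_const (1/2^3) * fps_X)
      + 1 / (1 - fps_const (1/2^2) * fps_X)
      + fps_const (1/2) / (1 - fps_const (1/2) * fps_X)"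
      \<comment> \<open>The instance at 1 handles the summand whose numerator is a bare
        \<open>1\<close>.\<close>
      unfolding fps_const_divide_linear[of 1, simplified] fps_const_divide_linear
        fps_compose_linear B_series_def
      by (rule fps_ext) (simp add: B)
  qed
qed

end
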